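(* For every integer $t\ge 9$, there is a family of trees $\{T_1,T_2,T_3\}$, each with $2t^3+2$ vertices and with pathwidth two, such that no isometric-universal graph for $\{T_1,T_2,T_3\}$ that is a tree is minimum (i.e., every isometric-universal tree for this family has strictly more vertices than a minimum isometric-universal graph for it).
   Context: Graphs are finite, simple and undirected. $\mathrm{dist}_G(u,v)$ denotes the number of edges of a shortest $u$–$v$ path in $G$ ($\infty$ if none exists). A subgraph $H$ of $G$ is an isometric subgraph if $\mathrm{dist}_H(u,v)=\mathrm{dist}_G(u,v)$ for all vertices $u,v$ of $H$. A graph $\mathcal U$ is an isometric-universal graph for a family $\mathcal F$ of graphs if every graph of $\mathcal F$ is isomorphic to an isometric subgraph of $\mathcal U$; it is minimum if it has the smallest possible number of vertices among all isometric-universal graphs for $\mathcal F$. The pathwidth of a graph $G$ is the smallest integer $p$ such that $G$ is a subgraph of some interval graph with maximum clique size $p+1$. *)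

theory Defs
  imports Complex_Main "HOL-Library.Extended_Nat"
begin

text \<open>Finite simple undirected graphs, vertices labelled by naturals
  (every finite graph is isomorphic to one of this form).
  A graph is a pair (V, E) with E a set of 2-element subsets of V.\<close>

type_synonym graph = "nat set \<times> nat set set"

definition verts :: "graph \<Rightarrow> nat set" where "verts G = fst G"
definition edges :: "graph \<Rightarrow> nat set set" where "edges G = snd G"

definition is_graph :: "graph \<Rightarrow> bool" where
  "is_graph G \<longleftrightarrow> finite (verts G) \<and>
     (\<forall>e\<in>edges G. \<exists>u v. e = {u, v} \<and> u \<noteq> v \<and> u \<in> verts G \<and> v \<in> verts G)"

fun walk :: "graph \<Rightarrow> nat \<Rightarrow> nat \<Rightarrow> nat \<Rightarrow> bool" where
  "walk G u v 0 \<longleftrightarrow> u = v \<and> u \<in> verts G"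
| "walk G u v (Suc n) \<longleftrightarrow> u \<in> verts G \<and> (\<exists>w. {u, w} \<in> edges G \<and> walk G w v n)"

definition dist :: "graph \<Rightarrow> nat \<Rightarrow> nat \<Rightarrow> enat" where
  "dist G u v = (if \<exists>n. walk G u v n then enat (LEAST n. walk G u v n) else \<infinity>)"

definition connected_graph :: "graph \<Rightarrow> bool" where
  "connected_graph G \<longleftrightarrow> (\<forall>u\<in>verts G. \<forall>v\<in>verts G. \<exists>n. walk G u v n)"

definition is_cycle :: "graph \<Rightarrow> nat list \<Rightarrow> bool" where
  "is_cycle G cs \<longleftrightarrow> length cs \<ge> 3 \<and> distinct cs \<and> set cs \<subseteq> verts G \<and>
     (\<forall>i. Suc i < length cs \<longrightarrow> {cs ! i, cs ! Suc i} \<in> edges G) \<and>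
     {last cs, hd cs} \<in> edges G"

definition is_tree :: "graph \<Rightarrow> bool" where
  "is_tree G \<longleftrightarrow> is_graph G \<and> verts G \<noteq> {} \<and> connected_graph G \<and>
     (\<nexists>cs. is_cycle G cs)"

definition subgraph :: "graph \<Rightarrow> graph \<Rightarrow> bool" where
  "subgraph H G \<longleftrightarrow> is_graph H \<and> verts H \<subseteq> verts G \<and> edges H \<subseteq> edges G"

definition isometric_subgraph :: "graph \<Rightarrow> graph \<Rightarrow> bool" where
  "isometric_subgraph H G \<longleftrightarrow> subgraph H G \<and>
     (\<forall>u\<in>verts H. \<forall>v\<in>verts H. dist H u v = dist G u v)"

definition isomorphic :: "graph \<Rightarrow> graph \<Rightarrow> bool" where
  "isomorphic G H \<longleftrightarrow> (\<exists>f. bij_betw f (verts G) (verts H) \<and>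
     (\<forall>u\<in>verts G. \<forall>v\<in>verts G. {u, v} \<in> edges G \<longleftrightarrow> {f u, f v} \<in> edges H))"

definition isometric_universal :: "graph \<Rightarrow> graph set \<Rightarrow> bool" where
  "isometric_universal U F \<longleftrightarrow> is_graph U \<and>
     (\<forall>G\<in>F. \<exists>H. isometric_subgraph H U \<and> isomorphic G H)"

definition min_universal_size :: "graph set \<Rightarrow> nat" where
  "min_universal_size F = (LEAST n. \<exists>U. isometric_universal U F \<and> card (verts U) = n)"

definition min_isometric_universal :: "graph \<Rightarrow> graph set \<Rightarrow> bool" where
  "min_isometric_universal U F \<longleftrightarrow> isometric_universal U F \<and>
     card (verts U) = min_universal_size F"

definition interval_graph :: "graph \<Rightarrow> bool" where
  "interval_graph H \<longleftrightarrow> is_graph H \<and> (\<exists>I :: nat \<Rightarrow> real \<times> real.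
     (\<forall>v\<in>verts H. fst (I v) \<le> snd (I v)) \<and>
     edges H = {{u, v} | u v. u \<in> verts H \<and> v \<in> verts H \<and> u \<noteq> v \<and>
        {fst (I u)..snd (I u)} \<inter> {fst (I v)..snd (I v)} \<noteq> {}})"

definition is_clique :: "graph \<Rightarrow> nat set \<Rightarrow> bool" where
  "is_clique G C \<longleftrightarrow> C \<subseteq> verts G \<and> (\<forall>u\<in>C. \<forall>v\<in>C. u \<noteq> v \<longrightarrow> {u, v} \<in> edges G)"

definition clique_number :: "graph \<Rightarrow> nat" where
  "clique_number G = Max {card C | C. is_clique G C}"

definition pathwidth :: "graph \<Rightarrow> nat" where
  "pathwidth G = (LEAST p. \<exists>H. interval_graph H \<and> subgraph G H \<and> clique_number H = p + 1)"

end

theory Submission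
  imports Defs
begin

text \<open>Put \<open>M = t ^ 3\<close>. For \<open>d = 2, 3, 4\<close> take a tree with two hubs of degree at least \<open>M - 2\<close> at
  distance \<open>d\<close> (and two arms of length two at one hub, which raise the pathwidth to two). A cycle of
  length \<open>2 + 3 + 4 = 9\<close> with three hubs contains all three trees isometrically, since each of the
  arcs is at most half of the cycle; this costs only \<open>3 M + O(1)\<close> vertices. In a tree, three hubs
  cannot realise all three distances, as \<open>9\<close> is odd and trees are bipartite. So a universal tree has at
  least four hubs, and since two vertices of a tree have at most one common neighbour, it has at
  least \<open>4 M - O(1)\<close> vertices.\<close>

section \<open>Walks, distances and nonexpansive maps\<close>

lemma walk_in_verts: "walk G u v n \<Longrightarrow> u \<in> verts G \<and> v \<in> verts G"
  by (induction n arbitrary: u) auto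

lemma walk_append: "walk G u v m \<Longrightarrow> walk G v w n \<Longrightarrow> walk G u w (m + n)"
  by (induction m arbitrary: u) auto

lemma walk_sym: "walk G u v n \<Longrightarrow> walk G v u n"
proof (induction n arbitrary: u)
  case (Suc n)
  then obtain w where w: "{u, w} \<in> edges G" "walk G w v n" and u: "u \<in> verts G" by auto
  have "walk G w u 1"
    using w u walk_in_verts[OF w(2)] by (auto simp: insert_commute)
  from walk_append[OF Suc.IH[OF w(2)] this] show ?case by simp
qed auto

text \<open>Each edge of the walk is either mapped to an edge or collapsed to a vertex; collapsed
  edges are dropped, so the image walk may be shorter.\<close>

lemma walk_nonexpansive:
  assumes V: "\<And>u. u \<in> verts G \<Longrightarrow> g u \<in> verts G'"
    and E: "\<And>u v. {u, v} \<in> edges G \<Longrightarrow> g u = g v \<or> {g u, g v} \<in> edges G'"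
  shows "walk G u v n \<Longrightarrow> \<exists>m\<le>n. walk G' (g u) (g v) m"
proof (induction n arbitrary: u)
  case 0
  then show ?case using V by auto
next
  case (Suc n)
  then obtain w where w: "{u, w} \<in> edges G" "walk G w v n" and u: "u \<in> verts G" by auto
  from Suc.IH[OF w(2)] obtain m where m: "m \<le> n" "walk G' (g w) (g v) m" by blast
  show ?case
  proof (cases "g u = g w")
    case True
    then show ?thesis using m by (intro exI[of _ m]) auto
  next
    case False
    then have "walk G' (g u) (g v) (Suc m)" using E[OF w(1)] m V[OF u] by auto
    then show ?thesis using m(1) by (intro exI[of _ "Suc m"]) auto
  qed
qed

lemma dist_le_walk: "walk G u v n \<Longrightarrow> dist G u v \<le> enat n"
  by (auto simp: dist_def intro: Least_le)

lemma walk_of_dist: "dist G u v = enat n \<Longrightarrow> walk G u v n"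
  by (auto simp: dist_def split: if_splits intro: LeastI)

lemma dist_commute: "dist G u v = dist G v u"
proof -
  have "walk G u v = walk G v u" by (auto intro: walk_sym)
  then show ?thesis by (simp add: dist_def)
qed

lemma dist_nonexpansive:
  assumes "\<And>u. u \<in> verts G \<Longrightarrow> g u \<in> verts G'"
    and "\<And>u v. {u, v} \<in> edges G \<Longrightarrow> g u = g v \<or> {g u, g v} \<in> edges G'"
  shows "dist G' (g u) (g v) \<le> dist G u v"
proof (cases "dist G u v")
  case (enat n)
  from walk_nonexpansive[of G g G', OF assms walk_of_dist[OF enat]]
  obtain m where "m \<le> n" "walk G' (g u) (g v) m" by blast
  then show ?thesis using dist_le_walk enat by (metis enat_ord_simps(1) order_trans)
qed auto

lemma edge_verts: "is_graph G \<Longrightarrow> {u, v} \<in> edges G \<Longrightarrow> u \<in> verts G \<and> v \<in> verts G \<and> u \<noteq> v"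
  unfolding is_graph_def by (metis doubleton_eq_iff)

section \<open>Isometric embeddings and retractions\<close>

text \<open>Both \<open>f\<close> and \<open>r\<close> are nonexpansive and \<open>r\<close> undoes
  \<open>f\<close>. With \<open>H\<close> the image of \<open>G\<close>, this closes the circle of
  inequalities from \<open>dist H\<close> to \<open>dist G\<close> to \<open>dist U\<close> and back
  to \<open>dist H\<close>. As \<open>r\<close> may collapse edges, it can absorb all of
  \<open>U\<close> that lies outside the image.\<close>

lemma retract_isometric:
  assumes G: "is_graph G"
    and f: "f ` verts G \<subseteq> verts U" "\<And>u v. {u, v} \<in> edges G \<Longrightarrow> {f u, f v} \<in> edges U"
    and r: "r ` verts U \<subseteq> verts G"
      "\<And>u v. {u, v} \<in> edges U \<Longrightarrow> r u = r v \<or> {r u, r v} \<in> edges G"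
    and rf: "\<And>v. v \<in> verts G \<Longrightarrow> r (f v) = v"
  shows "\<exists>H. isometric_subgraph H U \<and> isomorphic G H"
proof -
  define H where "H = (f ` verts G, (\<lambda>e. f ` e) ` edges G)"
  have VH: "verts H = f ` verts G" and EH: "edges H = (\<lambda>e. f ` e) ` edges G"
    by (auto simp: H_def verts_def edges_def)
  have inj: "inj_on f (verts G)" by (rule inj_on_inverseI[of _ r]) (rule rf)
  have Gsub: "e \<subseteq> verts G" if "e \<in> edges G" for e
    using that G unfolding is_graph_def by auto
  have edge: "\<exists>u v. e = {u, v} \<and> u \<noteq> v \<and> u \<in> verts G \<and> v \<in> verts G" if "e \<in> edges G" for e
    using that G unfolding is_graph_def by auto
  have "is_graph H"
    unfolding is_graph_def
  proof (intro conjI ballI)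
    show "finite (verts H)" using G by (simp add: VH is_graph_def)
    fix e assume "e \<in> edges H"
    then obtain e' where e': "e' \<in> edges G" "e = f ` e'" by (auto simp: EH)
    then obtain u v where "e' = {u, v}" "u \<noteq> v" "u \<in> verts G" "v \<in> verts G" using edge by blast
    then show "\<exists>u v. e = {u, v} \<and> u \<noteq> v \<and> u \<in> verts H \<and> v \<in> verts H"
      using e' inj by (intro exI[of _ "f u"] exI[of _ "f v"]) (simp add: VH inj_on_eq_iff)
  qed
  moreover have EHU: "edges H \<subseteq> edges U"
  proof
    fix e assume "e \<in> edges H"
    then obtain e' where e': "e' \<in> edges G" "e = f ` e'" by (auto simp: EH)
    then obtain u v where "e' = {u, v}" using edge by blast
    then show "e \<in> edges U" using f(2) e' by auto
  qed
  ultimately have sub: "subgraph H U" using f(1) by (simp add: subgraph_def VH)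
  have "dist H u v = dist U u v" if uv: "u \<in> verts H" "v \<in> verts H" for u v
  proof (rule antisym)
    obtain a b where ab: "a \<in> verts G" "b \<in> verts G" "u = f a" "v = f b" using uv by (auto simp: VH)
    have "dist H (f a) (f b) \<le> dist G a b"
    proof (rule dist_nonexpansive)
      show "f x = f y \<or> {f x, f y} \<in> edges H" if "{x, y} \<in> edges G" for x y
        using imageI[OF that, of "\<lambda>e. f ` e"] by (simp add: EH)
    qed (simp add: VH)
    also have "\<dots> = dist G (r u) (r v)" using ab rf by simp
    also have "\<dots> \<le> dist U u v"
      by (rule dist_nonexpansive) (use r in auto)
    finally show "dist H u v \<le> dist U u v" using ab by simp
    show "dist U u v \<le> dist H u v"
      using dist_nonexpansive[of H id U u v] f(1) EHU by (auto simp: VH)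
  qed
  then have "isometric_subgraph H U" using sub by (simp add: isometric_subgraph_def)
  moreover have "isomorphic G H"
    unfolding isomorphic_def
  proof (intro exI[of _ f] conjI ballI iffI)
    show "bij_betw f (verts G) (verts H)" using inj by (simp add: bij_betw_def VH)
    fix u v assume uv: "u \<in> verts G" "v \<in> verts G"
    show "{f u, f v} \<in> edges H" if "{u, v} \<in> edges G"
      using imageI[OF that, of "\<lambda>e. f ` e"] by (simp add: EH)
    assume "{f u, f v} \<in> edges H"
    then obtain e where e: "e \<in> edges G" "f ` {u, v} = f ` e" by (auto simp: EH)
    then have "{u, v} = e" using inj_on_image_eq_iff[OF inj, of "{u, v}" e] uv Gsub[OF e(1)] by auto
    then show "{u, v} \<in> edges G" using e by simp
  qed
  ultimately show ?thesis by blast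
qed

text \<open>An isomorphism is given by its effect on edges only; applying nonexpansiveness to it and
  to its inverse shows that it preserves distances.\<close>

lemma isometric_subgraph_embedding:
  assumes G: "is_graph G" and H: "isometric_subgraph H U" "isomorphic G H"
  obtains f where "inj_on f (verts G)" "f ` verts G \<subseteq> verts U"
    "\<And>u v. {u, v} \<in> edges G \<Longrightarrow> {f u, f v} \<in> edges U"
    "\<And>u v. u \<in> verts G \<Longrightarrow> v \<in> verts G \<Longrightarrow> dist U (f u) (f v) = dist G u v"
proof -
  from H(2) obtain f where bij: "bij_betw f (verts G) (verts H)"
    and E: "\<And>u v. u \<in> verts G \<Longrightarrow> v \<in> verts G \<Longrightarrow> {u, v} \<in> edges G \<longleftrightarrow> {f u, f v} \<in> edges H"
    unfolding isomorphic_def by blast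
  define g where "g = the_inv_into (verts G) f"
  have inj: "inj_on f (verts G)" and im: "f ` verts G = verts H"
    using bij by (auto simp: bij_betw_def)
  have gf: "g (f u) = u" if "u \<in> verts G" for u
    using the_inv_into_f_f[OF inj that] by (simp add: g_def)
  have isH: "is_graph H" and HU: "verts H \<subseteq> verts U" "edges H \<subseteq> edges U"
    and D: "\<And>u v. u \<in> verts H \<Longrightarrow> v \<in> verts H \<Longrightarrow> dist H u v = dist U u v"
    using H(1) by (auto simp: isometric_subgraph_def subgraph_def)
  have EH: "{f u, f v} \<in> edges H" if "{u, v} \<in> edges G" for u v
    using E edge_verts[OF G that] that by blast
  show thesis
  proof
    show "inj_on f (verts G)" by (fact inj)
    show "f ` verts G \<subseteq> verts U" using im HU by simp
    show "{f u, f v} \<in> edges U" if "{u, v} \<in> edges G" for u v using EH[OF that] HU by blast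
    fix u v assume uv: "u \<in> verts G" "v \<in> verts G"
    have "dist H (f u) (f v) \<le> dist G u v"
      by (rule dist_nonexpansive) (use im EH in auto)
    moreover have "dist G (g (f u)) (g (f v)) \<le> dist H (f u) (f v)"
    proof (rule dist_nonexpansive)
      show "g w \<in> verts G" if "w \<in> verts H" for w using that im gf by (metis imageE)
      show "g w = g z \<or> {g w, g z} \<in> edges G" if wz: "{w, z} \<in> edges H" for w z
      proof -
        obtain a b where "a \<in> verts G" "b \<in> verts G" "w = f a" "z = f b"
          using edge_verts[OF isH wz] im by (metis imageE)
        then show ?thesis using E gf wz by auto
      qed
    qed
    ultimately have "dist H (f u) (f v) = dist G u v" using gf uv by simp
    then show "dist U (f u) (f v) = dist G u v" using D[of "f u" "f v"] im uv by (metis image_eqI)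
  qed
qed

section \<open>Odd closed walks contain cycles\<close>

lemma walk_imp_fun:
  "walk G u v n \<Longrightarrow> \<exists>p. p 0 = u \<and> p n = v \<and> (\<forall>i\<le>n. p i \<in> verts G) \<and>
     (\<forall>i<n. {p i, p (Suc i)} \<in> edges G)"
proof (induction n arbitrary: u)
  case 0
  then show ?case by (intro exI[of _ "\<lambda>_. u"]) auto
next
  case (Suc n)
  then obtain w where w: "{u, w} \<in> edges G" "walk G w v n" and u: "u \<in> verts G" by auto
  from Suc.IH[OF w(2)] obtain p where p: "p 0 = w" "p n = v" "\<forall>i\<le>n. p i \<in> verts G"
    "\<forall>i<n. {p i, p (Suc i)} \<in> edges G" by blast
  then show ?case using u w
    by (intro exI[of _ "case_nat u p"]) (auto split: nat.split)
qed

lemma walk_of_fun: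
  assumes "\<forall>i\<le>n. p i \<in> verts G" "\<forall>i<n. {p i, p (Suc i)} \<in> edges G"
  shows "i \<le> j \<Longrightarrow> j \<le> n \<Longrightarrow> walk G (p i) (p j) (j - i)"
proof (induction "j - i" arbitrary: i)
  case 0
  then show ?case using assms by auto
next
  case (Suc k)
  then have "walk G (p (Suc i)) (p j) (j - Suc i)" by auto
  moreover have "j - i = Suc (j - Suc i)" using Suc by auto
  moreover have "p i \<in> verts G" "{p i, p (Suc i)} \<in> edges G" using assms Suc by auto
  ultimately show ?case by auto
qed

text \<open>A shortest odd closed walk repeats no vertex: a repetition would split it into two closed
  walks, one of which is odd.\<close>

lemma odd_closed_walk_imp_cycle:
  assumes G: "is_graph G" and n: "odd n" "walk G u u n"
  shows "\<exists>cs. is_cycle G cs"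
proof -
  define P where "P k \<longleftrightarrow> odd k \<and> (\<exists>u. walk G u u k)" for k
  have Pn: "P n" using n by (auto simp: P_def)
  define l where "l = (LEAST k. P k)"
  have l: "P l" and least: "\<And>k. P k \<Longrightarrow> l \<le> k"
    unfolding l_def using LeastI[of P n] Pn Least_le[of P] by auto
  from l obtain a where a: "odd l" "walk G a a l" by (auto simp: P_def)
  from walk_imp_fun[OF a(2)] obtain p where p: "p 0 = a" "p l = a"
    "\<forall>i\<le>l. p i \<in> verts G" "\<forall>i<l. {p i, p (Suc i)} \<in> edges G" by blast
  note W = walk_of_fun[OF p(3,4)]
  have neq: "p i \<noteq> p j" if ij: "i < j" "j < l" for i j
  proof
    assume eq: "p i = p j"
    have "walk G (p i) (p i) (j - i)" using W[of i j] ij eq by simp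
    moreover have "walk G a a (i + (l - j))"
      using walk_append[OF W[of 0 i] _, of "p l" "l - j"] W[of j l] ij eq p by simp
    moreover have "odd (j - i) \<or> odd (i + (l - j))" using a(1) ij by presburger
    ultimately have "P (j - i) \<or> P (i + (l - j))" by (auto simp: P_def)
    then show False using least ij by fastforce
  qed
  have inj: "inj_on p {0..<l}"
    by (intro linorder_inj_onI) (use neq in auto)
  \<comment> \<open>A closed walk of length one would be a loop. With that excluded, oddness yields
    the length of at least three that \<open>is_cycle\<close> demands.\<close>
  have "l \<noteq> 1"
  proof
    assume "l = 1"
    then have "{p 0, p 0} \<in> edges G" using p by auto
    then show False using edge_verts[OF G] by blast
  qed
  then have l3: "l \<ge> 3" using a(1) by presburger
  have "is_cycle G (map p [0..<l])"
    unfolding is_cycle_def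
  proof (intro conjI allI impI)
    show "{last (map p [0..<l]), hd (map p [0..<l])} \<in> edges G"
      using l3 p(1,2) p(4)[rule_format, of "l - 1"]
      by (simp add: last_map hd_map)
  qed (use l3 inj p(3,4) in \<open>auto simp: distinct_map\<close>)
  then show ?thesis ..
qed

section \<open>Neighbourhoods in acyclic graphs\<close>

definition nbrs :: "graph \<Rightarrow> nat \<Rightarrow> nat set" where
  "nbrs G u = {v. {u, v} \<in> edges G}"

lemma nbrs_subset: "is_graph G \<Longrightarrow> nbrs G u \<subseteq> verts G"
  unfolding nbrs_def using edge_verts by blast

lemma finite_nbrs: "is_graph G \<Longrightarrow> finite (nbrs G u)"
  by (meson finite_subset is_graph_def nbrs_subset)

text \<open>Two common neighbours would close a cycle of length four.\<close>

lemma acyclic_common_nbrs: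
  assumes G: "is_graph G" and acyc: "\<nexists>cs. is_cycle G cs" and "u \<noteq> v"
  shows "card (nbrs G u \<inter> nbrs G v) \<le> 1"
proof -
  have "x = y" if x: "x \<in> nbrs G u \<inter> nbrs G v" and y: "y \<in> nbrs G u \<inter> nbrs G v" for x y
  proof (rule ccontr)
    assume "x \<noteq> y"
    have "{u, x} \<in> edges G" "{x, v} \<in> edges G" "{v, y} \<in> edges G" "{y, u} \<in> edges G"
      using x y by (auto simp: nbrs_def insert_commute)
    moreover from this have "is_cycle G [u, x, v, y]"
      using \<open>x \<noteq> y\<close> \<open>u \<noteq> v\<close> edge_verts[OF G]
      by (auto simp: is_cycle_def less_Suc_eq numeral_nat nth_Cons' dest: edge_verts[OF G])
    ultimately show False using acyc by blast
  qed
  then show ?thesis using finite_nbrs[OF G]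
    by (metis One_nat_def card_le_Suc0_iff_eq finite_Int)
qed

text \<open>When the vertices of \<open>S\<close> are added one at a time, each new one shares at
  most one neighbour with every earlier one. The overlaps therefore add up to at most
  \<open>0 + 1 + ... + (card S - 1)\<close>, which is \<open>card S choose 2\<close>.\<close>

lemma acyclic_degree_bound:
  assumes G: "is_graph G" and acyc: "\<nexists>cs. is_cycle G cs"
    and "finite S" "\<And>v. v \<in> S \<Longrightarrow> k \<le> card (nbrs G v)"
  shows "card S * k \<le> card (\<Union>v\<in>S. nbrs G v) + (card S choose 2)"
  using assms(3,4)
proof (induction S rule: finite_induct)
  case (insert x S)
  let ?N = "\<Union>v\<in>S. nbrs G v"
  have fin: "finite ?N" "finite (nbrs G x)" using insert finite_nbrs[OF G] by auto
  have "card (?N \<inter> nbrs G x) = card (\<Union>v\<in>S. nbrs G v \<inter> nbrs G x)" by simp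
  also have "\<dots> \<le> (\<Sum>v\<in>S. card (nbrs G v \<inter> nbrs G x))" by (rule card_UN_le) fact
  also have "\<dots> \<le> (\<Sum>v\<in>S. 1)"
    using insert by (intro sum_mono acyclic_common_nbrs[OF G acyc]) auto
  finally have "card (?N \<inter> nbrs G x) \<le> card S" by simp
  moreover have "card ?N + card (nbrs G x) = card (?N \<union> nbrs G x) + card (?N \<inter> nbrs G x)"
    by (rule card_Un_Int) (use fin in auto)
  moreover have "card S * k \<le> card ?N + (card S choose 2)" "k \<le> card (nbrs G x)"
    using insert by (auto intro: insert.IH)
  moreover have "(Suc (card S) choose 2) = (card S choose 2) + card S"
    by (simp add: numeral_2_eq_2)
  moreover have "(\<Union>v\<in>insert x S. nbrs G v) = ?N \<union> nbrs G x" by auto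
  ultimately show ?case using insert.hyps by simp
qed simp

text \<open>Serves for lower bounds on distances: a potential that grows by at most one along each
  edge forces a walk to be at least as long as the growth between its ends.\<close>

lemma walk_lipschitz:
  fixes \<phi> :: "nat \<Rightarrow> nat"
  assumes "\<And>u v. {u, v} \<in> edges G \<Longrightarrow> \<phi> v \<le> \<phi> u + 1"
  shows "walk G u v n \<Longrightarrow> \<phi> v \<le> \<phi> u + n"
proof (induction n arbitrary: u)
  case (Suc n)
  then obtain w where "{u, w} \<in> edges G" "walk G w v n" by auto
  with Suc.IH[of w] assms[of u w] show ?case by simp
qed auto

section \<open>Trees given by a parent function\<close>

text \<open>The root is \<open>0\<close>, and the value of \<open>p\<close> there is ignored. Each
  other vertex contributes the edge to its parent; if parents have smaller numbers, following them
  ends at the root.\<close>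

definition parent_tree :: "nat \<Rightarrow> (nat \<Rightarrow> nat) \<Rightarrow> graph" where
  "parent_tree n p = ({..<n}, (\<lambda>v. {v, p v}) ` {0<..<n})"

lemma verts_parent_tree [simp]: "verts (parent_tree n p) = {..<n}"
  by (simp add: parent_tree_def verts_def)

lemma edges_parent_tree: "edges (parent_tree n p) = (\<lambda>v. {v, p v}) ` {0<..<n}"
  by (simp add: parent_tree_def edges_def)

lemma edge_parent_tree_iff:
  "{u, v} \<in> edges (parent_tree n p) \<longleftrightarrow>
     (0 < u \<and> u < n \<and> v = p u) \<or> (0 < v \<and> v < n \<and> u = p v)"
  by (auto simp: edges_parent_tree doubleton_eq_iff)

lemma is_cycle_edge_mod:
  assumes "is_cycle G cs" "i < length cs"
  shows "{cs ! i, cs ! (Suc i mod length cs)} \<in> edges G"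
proof (cases "Suc i < length cs")
  case False
  then have "Suc i = length cs" using assms(2) by simp
  then have "i = length cs - 1" "cs \<noteq> []" by auto
  then show ?thesis using assms(1) \<open>Suc i = length cs\<close>
    by (simp add: is_cycle_def last_conv_nth hd_conv_nth)
qed (use assms in \<open>auto simp: is_cycle_def\<close>)

text \<open>The largest vertex of a cycle would have two distinct smaller neighbours, but its only smaller
  neighbour is its parent.\<close>

lemma is_tree_parent_tree:
  assumes n: "0 < n" and p: "\<And>v. 0 < v \<Longrightarrow> v < n \<Longrightarrow> p v < v"
  shows "is_tree (parent_tree n p)"
proof -
  let ?T = "parent_tree n p"
  have G: "is_graph ?T"
    unfolding is_graph_def
  proof (intro conjI ballI)
    fix e assume "e \<in> edges ?T"
    then obtain v where "0 < v" "v < n" "e = {v, p v}" by (auto simp: edges_parent_tree)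
    then show "\<exists>u v. e = {u, v} \<and> u \<noteq> v \<and> u \<in> verts ?T \<and> v \<in> verts ?T"
      using p[of v] by (intro exI[of _ v] exI[of _ "p v"]) auto
  qed simp
  have root: "\<exists>k. walk ?T v 0 k" if "v < n" for v
    using that
  proof (induction v rule: less_induct)
    case (less v)
    show ?case
    proof (cases "v = 0")
      case True
      then show ?thesis using n by (intro exI[of _ 0]) auto
    next
      case False
      then obtain k where "walk ?T (p v) 0 k" using less p[of v] by (metis less_trans neq0_conv)
      then have "walk ?T v 0 (Suc k)"
        using False less.prems by (auto simp: edge_parent_tree_iff intro!: exI[of _ "p v"])
      then show ?thesis ..
    qed
  qed
  have conn: "connected_graph ?T"
    unfolding connected_graph_def
  proof (intro ballI)
    fix u v assume "u \<in> verts ?T" "v \<in> verts ?T"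
    then obtain k l where "walk ?T u 0 k" "walk ?T v 0 l" using root by fastforce
    then show "\<exists>n. walk ?T u v n" using walk_append walk_sym by blast
  qed
  have "\<not> is_cycle ?T cs" for cs
  proof
    assume c: "is_cycle ?T cs"
    let ?l = "length cs"
    have l: "?l \<ge> 3" and dist: "distinct cs" and sub: "set cs \<subseteq> {..<n}"
      using c by (auto simp: is_cycle_def)
    define m where "m = Max (set cs)"
    have "m \<in> set cs" unfolding m_def using l by (intro Max_in) auto
    then obtain i where i: "i < ?l" "cs ! i = m" by (auto simp: in_set_conv_nth)
    have only_parent: "x = p m" if x: "{m, x} \<in> edges ?T" "x \<in> set cs" for x
    proof -
      have "x \<le> m" using x(2) by (simp add: m_def)
      with x(1) p[of x] show ?thesis by (auto simp: edge_parent_tree_iff)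
    qed
    \<comment> \<open>\<open>j\<close> and \<open>k\<close> are the positions before and after
      \<open>i\<close> in cyclic order; they differ because the length is at least three.\<close>
    define j where "j = (if i = 0 then ?l - 1 else i - 1)"
    define k where "k = (if Suc i = ?l then 0 else Suc i)"
    have jk: "j < ?l" "k < ?l" "j \<noteq> k" "Suc j mod ?l = i" "Suc i mod ?l = k"
      using i(1) l by (auto simp: j_def k_def)
    have "cs ! k = p m"
      using is_cycle_edge_mod[OF c i(1)] i jk by (intro only_parent) auto
    moreover have "cs ! j = p m"
      using is_cycle_edge_mod[OF c jk(1)] i jk by (intro only_parent) (auto simp: insert_commute)
    ultimately show False using dist jk by (metis nth_eq_iff_index_eq)
  qed
  then show ?thesis using G conn n by (auto simp: is_tree_def)
qed

section \<open>Pathwidth two through interval graphs\<close>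

lemma finite_clique_cards: "is_graph G \<Longrightarrow> finite {card C | C. is_clique G C}"
  by (rule finite_subset[of _ "card ` Pow (verts G)"]) (auto simp: is_clique_def is_graph_def)

text \<open>If the graph had no triangle, the arms of the spider would start with pairwise disjoint
  intervals; the middle one lies inside the interval of the centre, and so the end of this arm
  meets the centre.\<close>

lemma interval_spider_clique:
  assumes H: "interval_graph H" and dist: "distinct [c, a1, a2, a3, b1, b2, b3]"
    and E: "{c, a1} \<in> edges H" "{c, a2} \<in> edges H" "{c, a3} \<in> edges H"
      "{a1, b1} \<in> edges H" "{a2, b2} \<in> edges H" "{a3, b3} \<in> edges H"
  shows "3 \<le> clique_number H"
proof -
  have G: "is_graph H" using H by (simp add: interval_graph_def)
  from H obtain I :: "nat \<Rightarrow> real \<times> real" where I: "\<forall>v\<in>verts H. fst (I v) \<le> snd (I v)"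
    and EH: "edges H = {{u, v} | u v. u \<in> verts H \<and> v \<in> verts H \<and> u \<noteq> v \<and>
        {fst (I u)..snd (I u)} \<inter> {fst (I v)..snd (I v)} \<noteq> {}}"
    by (auto simp: interval_graph_def)
  define lo hi where "lo v = fst (I v)" and "hi v = snd (I v)" for v
  have adj: "{u, v} \<in> edges H \<longleftrightarrow>
      u \<in> verts H \<and> v \<in> verts H \<and> u \<noteq> v \<and> lo u \<le> hi v \<and> lo v \<le> hi u" for u v
    using I by (auto simp: EH doubleton_eq_iff lo_def hi_def)
  have V: "c \<in> verts H" "a1 \<in> verts H" "a2 \<in> verts H" "a3 \<in> verts H"
    "b1 \<in> verts H" "b2 \<in> verts H" "b3 \<in> verts H"
    using E by (auto simp: adj)
  have "\<exists>x y z. distinct [x, y, z] \<and> {x, y} \<in> edges H \<and> {x, z} \<in> edges H \<and> {y, z} \<in> edges H"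
  proof (rule ccontr)
    assume no: "\<not> ?thesis"
    \<comment> \<open>\<open>y\<close> lies between \<open>x\<close> and \<open>z\<close>, both of
      which meet \<open>c\<close>, so the interval of \<open>c\<close> covers that of
      \<open>y\<close>. Whatever meets \<open>y\<close>, in particular \<open>b\<close>, then meets
      \<open>c\<close>.\<close>
    have mid: False if "hi x < lo y" "hi y < lo z" "{c, x} \<in> edges H" "{c, y} \<in> edges H"
      "{c, z} \<in> edges H" "{y, b} \<in> edges H" "c \<noteq> b" for x y z b
    proof -
      have "{c, b} \<in> edges H" using that by (auto simp: adj)
      moreover have "distinct [c, y, b]"
        using edge_verts[OF G] that by (metis distinct_length_2_or_more distinct_singleton)
      ultimately show False using no that by blast
    qed
    have disj: "hi x < lo y \<or> hi y < lo x" if "{c, x} \<in> edges H" "{c, y} \<in> edges H" "x \<noteq> y" for x y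
    proof (rule ccontr)
      assume "\<not> ?thesis"
      then have "{x, y} \<in> edges H" using that by (auto simp: adj)
      moreover have "distinct [c, x, y]"
        using edge_verts[OF G] that by (metis distinct_length_2_or_more distinct_singleton)
      ultimately show False using no that by blast
    qed
    have disj3: "hi a1 < lo a2 \<or> hi a2 < lo a1" "hi a1 < lo a3 \<or> hi a3 < lo a1"
      "hi a2 < lo a3 \<or> hi a3 < lo a2"
      using disj E dist by auto
    have "c \<noteq> b1" "c \<noteq> b2" "c \<noteq> b3" using dist by auto
    \<comment> \<open>One exclusion for each of the six orders in which three disjoint intervals can
      lie on the line.\<close>
    then have "\<not> (hi a1 < lo a2 \<and> hi a2 < lo a3)" "\<not> (hi a3 < lo a2 \<and> hi a2 < lo a1)"
      "\<not> (hi a2 < lo a1 \<and> hi a1 < lo a3)" "\<not> (hi a3 < lo a1 \<and> hi a1 < lo a2)"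
      "\<not> (hi a1 < lo a3 \<and> hi a3 < lo a2)" "\<not> (hi a2 < lo a3 \<and> hi a3 < lo a1)"
      using mid E by blast+
    with disj3 show False by argo
  qed
  then obtain x y z where "distinct [x, y, z]" "{x, y} \<in> edges H" "{x, z} \<in> edges H" "{y, z} \<in> edges H"
    by blast
  then have "is_clique H {x, y, z}" "card {x, y, z} = 3"
    using edge_verts[OF G] by (auto simp: is_clique_def insert_commute)
  then have "3 \<in> {card C | C. is_clique H C}" by force
  then show ?thesis unfolding clique_number_def by (rule Max_ge[OF finite_clique_cards[OF G]])
qed

text \<open>Interval graphs are perfect, so a colouring with three colours certifies that all cliques
  have size at most three.\<close>

lemma pathwidth_eq_2I:
  fixes lo hi :: "nat \<Rightarrow> real" and col :: "nat \<Rightarrow> nat"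
  assumes G: "is_graph G" and dist: "distinct [c, a1, a2, a3, b1, b2, b3]"
    and E: "{c, a1} \<in> edges G" "{c, a2} \<in> edges G" "{c, a3} \<in> edges G"
      "{a1, b1} \<in> edges G" "{a2, b2} \<in> edges G" "{a3, b3} \<in> edges G"
    and lohi: "\<And>v. v \<in> verts G \<Longrightarrow> lo v \<le> hi v"
    and meet: "\<And>u v. {u, v} \<in> edges G \<Longrightarrow> lo u \<le> hi v"
    and col: "\<And>v. v \<in> verts G \<Longrightarrow> col v < 3"
    and disj: "\<And>u v. u \<in> verts G \<Longrightarrow> v \<in> verts G \<Longrightarrow> u < v \<Longrightarrow> col u = col v \<Longrightarrow> hi u < lo v"
  shows "pathwidth G = 2"
proof -
  define H where "H = (verts G, {{u, v} | u v. u \<in> verts G \<and> v \<in> verts G \<and> u \<noteq> v \<and>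
        {lo u..hi u} \<inter> {lo v..hi v} \<noteq> {}})"
  have VH: "verts H = verts G" and EH: "edges H = {{u, v} | u v. u \<in> verts G \<and> v \<in> verts G \<and> u \<noteq> v \<and>
        {lo u..hi u} \<inter> {lo v..hi v} \<noteq> {}}"
    by (auto simp: H_def verts_def edges_def)
  have isH: "is_graph H" using G by (auto simp: is_graph_def VH EH)
  have int: "interval_graph H"
    unfolding interval_graph_def
    by (intro conjI isH exI[of _ "\<lambda>v. (lo v, hi v)"]) (auto simp: VH EH lohi)
  have sub: "subgraph G H"
    unfolding subgraph_def
  proof (intro conjI G subsetI)
    fix e assume e: "e \<in> edges G"
    then obtain u v where uv: "e = {u, v}" "u \<noteq> v" "u \<in> verts G" "v \<in> verts G"
      using G by (auto simp: is_graph_def)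
    then have "max (lo u) (lo v) \<in> {lo u..hi u} \<inter> {lo v..hi v}"
      using meet[of u v] meet[of v u] lohi e by (auto simp: insert_commute)
    then show "e \<in> edges H" using uv by (auto simp: EH)
  qed (simp add: VH)
  have le: "clique_number H \<le> 3"
    unfolding clique_number_def
  proof (rule Max.boundedI[OF finite_clique_cards[OF isH]])
    show "{card C | C. is_clique H C} \<noteq> {}" by (auto simp: is_clique_def intro: exI[of _ "{}"])
    fix k assume "k \<in> {card C | C. is_clique H C}"
    then obtain C where C: "k = card C" "C \<subseteq> verts G"
      "\<forall>u\<in>C. \<forall>v\<in>C. u \<noteq> v \<longrightarrow> {u, v} \<in> edges H" by (auto simp: is_clique_def VH)
    have "inj_on col C"
    proof (rule linorder_inj_onI)
      fix u v assume uv: "u < v" "u \<in> C" "v \<in> C"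
      then have "{lo u..hi u} \<inter> {lo v..hi v} \<noteq> {}"
        using C(3)[rule_format, of u v] by (auto simp: EH doubleton_eq_iff)
      then show "col u \<noteq> col v" using disj[of u v] uv C(2) by auto
    qed auto
    moreover have "col ` C \<subseteq> {..<3}" using C(2) col by auto
    ultimately show "k \<le> 3" using C(1) card_inj_on_le[of col C "{..<3}"] by simp
  qed
  \<comment> \<open>The spider survives in every supergraph, so the lower bound applies to all
    competing interval graphs at once.\<close>
  have ge: "3 \<le> clique_number H'" if "interval_graph H'" "subgraph G H'" for H'
    using that(2) E by (intro interval_spider_clique[OF that(1) dist]) (auto simp: subgraph_def)
  have "clique_number H = 2 + 1" using le ge[OF int sub] by simp
  with int sub show ?thesis
    unfolding pathwidth_def
  proof (intro Least_equality exI[of _ H] conjI)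
    fix p assume "\<exists>H. interval_graph H \<and> subgraph G H \<and> clique_number H = p + 1"
    then obtain H' where "interval_graph H'" "subgraph G H'" "clique_number H' = p + 1" by blast
    then show "2 \<le> p" using ge[of H'] by simp
  qed
qed

section \<open>The trees with two hubs\<close>

text \<open>Hub \<open>0\<close> carries the arms \<open>1 - 2\<close> and \<open>3 - 4\<close> and the leaves \<open>5, \<dots>, M\<close>; the path
  \<open>0, M + 1, \<dots>, M + d\<close> leads to the hub \<open>M + d\<close>, which carries all remaining vertices.\<close>

definition hub_parent :: "nat \<Rightarrow> nat \<Rightarrow> nat \<Rightarrow> nat" where
  "hub_parent M d v = (if v = 2 then 1 else if v = 4 then 3 else if v \<le> M + 1 then 0
     else if v \<le> M + d then v - 1 else M + d)"

definition hub_tree :: "nat \<Rightarrow> nat \<Rightarrow> graph" where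
  "hub_tree M d = parent_tree (2 * M + 2) (hub_parent M d)"

lemma verts_hub_tree [simp]: "verts (hub_tree M d) = {..<2 * M + 2}"
  by (simp add: hub_tree_def)

lemma edge_hub_tree_iff:
  "{u, v} \<in> edges (hub_tree M d) \<longleftrightarrow>
     (0 < u \<and> u < 2 * M + 2 \<and> v = hub_parent M d u) \<or>
     (0 < v \<and> v < 2 * M + 2 \<and> u = hub_parent M d v)"
  by (simp add: hub_tree_def edge_parent_tree_iff)

lemma is_tree_hub_tree: "is_tree (hub_tree M d)"
  unfolding hub_tree_def by (rule is_tree_parent_tree) (auto simp: hub_parent_def)

lemma is_graph_hub_tree: "is_graph (hub_tree M d)"
  using is_tree_hub_tree by (simp add: is_tree_def)

lemma pathwidth_hub_tree:
  assumes M: "5 \<le> M" and d: "2 \<le> d" "d \<le> M"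
  shows "pathwidth (hub_tree M d) = 2"
proof -
  \<comment> \<open>The interval of a vertex runs from its own number to that of its largest child,
    or is a single point at a leaf. Thus it contains the left end of the interval of each
    child.\<close>
  define last_child where "last_child v =
    (if v = 0 then M + 1 else if v = 1 then 2 else if v = 3 then 4 else if v \<le> M then v
     else if v < M + d then v + 1 else if v = M + d then 2 * M + 1 else v)" for v
  \<comment> \<open>Colours alternate between \<open>1\<close> and \<open>2\<close> along the path,
    where consecutive intervals touch. Colour \<open>0\<close> is left for hub \<open>0\<close> and
    for the leaves of the other hub, which lie inside the long interval of that hub.\<close>
  define col :: "nat \<Rightarrow> nat" where "col v =
    (if v = 0 then 0 else if v = 2 \<or> v = 4 then 2 else if v \<le> M then 1
     else if v \<le> M + d then 1 + (v - M - 1) mod 2 else 0)" for v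
  show ?thesis
  \<comment> \<open>The third arm of the spider consists of the first two steps towards the other
    hub, which exist since \<open>d \<ge> 2\<close>.\<close>
  proof (rule pathwidth_eq_2I[where lo = real and hi = "\<lambda>v. real (last_child v)" and col = col
        and c = 0 and ?a1.0 = 1 and ?b1.0 = 2 and ?a2.0 = 3 and ?b2.0 = 4
        and ?a3.0 = "M + 1" and ?b3.0 = "M + 2"])
    show "real u \<le> real (last_child v)" if "{u, v} \<in> edges (hub_tree M d)" for u v
      using that M d by (auto simp: edge_hub_tree_iff hub_parent_def last_child_def split: if_splits)
    show "real (last_child u) < real v"
      if "u \<in> verts (hub_tree M d)" "v \<in> verts (hub_tree M d)" "u < v" "col u = col v" for u v
    proof -
      have "last_child u < v"
      proof (cases "M < u \<and> u < M + d")
        case True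
        moreover have "v \<noteq> u + 1"
        proof
          assume v: "v = u + 1"
          define i where "i = u - M - 1"
          have i: "u = M + 1 + i" using True by (simp add: i_def)
          have "col u = 1 + i mod 2" "col v = 1 + Suc i mod 2"
            using i v True M by (auto simp: col_def)
          with that(4) have "i mod 2 = Suc i mod 2" by simp
          then show False by presburger
        qed
        ultimately show ?thesis using that(3) M by (auto simp: last_child_def)
      next
        case False
        then show ?thesis using that M d
          by (auto simp: last_child_def col_def split: if_splits)
      qed
      then show ?thesis by simp
    qed
  qed (use M d is_graph_hub_tree in
      \<open>auto simp: edge_hub_tree_iff hub_parent_def last_child_def col_def\<close>)
qed

lemma dist_hub_tree:
  assumes M: "5 \<le> M" and d: "2 \<le> d" "d \<le> M"
  shows "dist (hub_tree M d) 0 (M + d) = enat d"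
proof -
  let ?T = "hub_tree M d"
  have "walk ?T (M + Suc i) 0 (Suc i)" if "Suc i \<le> d" for i
    using that
  proof (induction i)
    case 0
    then show ?case using M d by (auto simp: edge_hub_tree_iff hub_parent_def)
  next
    case (Suc i)
    then have "walk ?T (M + Suc i) 0 (Suc i)" by simp
    moreover have "{M + Suc (Suc i), M + Suc i} \<in> edges ?T" "M + Suc (Suc i) \<in> verts ?T"
      using Suc.prems M d by (auto simp: edge_hub_tree_iff hub_parent_def)
    ultimately show ?case unfolding walk.simps(2)[of _ _ _ "Suc i"] by blast
  qed
  from this[of "d - 1"] have w: "walk ?T 0 (M + d) d" using d by (simp add: walk_sym)
  \<comment> \<open>The projection to the path between the hubs: \<open>\<phi>\<close> is the
    position on the path, and everything attached to a hub gets the position of that hub.\<close>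
  define \<phi> where "\<phi> v = (if v \<le> M then 0 else if v \<le> M + d then v - M else d)" for v
  have lip: "\<phi> v \<le> \<phi> u + 1" if "{u, v} \<in> edges ?T" for u v
    using that M d by (auto simp: edge_hub_tree_iff hub_parent_def \<phi>_def split: if_splits)
  have "d \<le> n" if "walk ?T 0 (M + d) n" for n
    using walk_lipschitz[of ?T \<phi>, OF lip that] d by (simp add: \<phi>_def split: if_splits)
  then show ?thesis using w by (auto simp: dist_def intro!: Least_equality)
qed

text \<open>Hub \<open>M + d\<close> has the path vertex before it and \<open>M - d + 1\<close>
  leaves as neighbours, and \<open>M - d + 2 \<ge> M - 2\<close> as \<open>d \<le> 4\<close>. At hub
  \<open>0\<close> it suffices to count \<open>1\<close> and \<open>5, ..., M + 1\<close>.\<close>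

lemma degree_hub_tree:
  assumes M: "5 \<le> M" and d: "2 \<le> d" "d \<le> 4"
  shows "M - 2 \<le> card (nbrs (hub_tree M d) 0)" "M - 2 \<le> card (nbrs (hub_tree M d) (M + d))"
proof -
  note fin = finite_nbrs[OF is_graph_hub_tree]
  have "insert 1 {5..M + 1} \<subseteq> nbrs (hub_tree M d) 0"
    using M d by (auto simp: nbrs_def edge_hub_tree_iff hub_parent_def)
  from card_mono[OF fin this] show "M - 2 \<le> card (nbrs (hub_tree M d) 0)" using M by simp
  have "insert (M + d - 1) {M + d + 1..2 * M + 1} \<subseteq> nbrs (hub_tree M d) (M + d)"
    using M d by (auto simp: nbrs_def edge_hub_tree_iff hub_parent_def)
  from card_mono[OF fin this] show "M - 2 \<le> card (nbrs (hub_tree M d) (M + d))"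
    using M d by simp
qed

section \<open>The cycle with three hubs contains all three trees isometrically\<close>

text \<open>The vertices below \<open>9\<close> form a cycle with hubs \<open>0\<close>, \<open>2\<close>, \<open>5\<close> at pairwise distances \<open>2\<close>, \<open>3\<close>,
  \<open>4\<close>; a vertex \<open>w \<ge> 9\<close> is pendant at the hub with index \<open>w mod 3\<close>, except that two vertices in
  each class are the ends of arms of length two.\<close>

definition cycle_hub :: "nat \<Rightarrow> nat" where
  "cycle_hub k = (if k = 0 then 0 else if k = 1 then 2 else 5)"

definition cycle_next :: "nat \<Rightarrow> nat" where
  "cycle_next w = (if w < 9 then (w + 1) mod 9 else if 12 \<le> w \<and> w < 15 \<or> 18 \<le> w \<and> w < 21 then w - 3
     else cycle_hub (w mod 3))"

text \<open>Besides the \<open>9\<close> cycle vertices there are \<open>M + 3\<close> vertices for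
  each hub. That many are needed for \<open>d = 2\<close>, where the leaves of the second hub are
  placed at the indices \<open>5, ..., M + 3\<close>.\<close>

definition hub_cycle :: "nat \<Rightarrow> graph" where
  "hub_cycle M = ({..<3 * M + 18}, (\<lambda>w. {w, cycle_next w}) ` {..<3 * M + 18})"

lemma verts_hub_cycle [simp]: "verts (hub_cycle M) = {..<3 * M + 18}"
  by (simp add: hub_cycle_def verts_def)

lemma edge_hub_cycle_iff:
  "{u, v} \<in> edges (hub_cycle M) \<longleftrightarrow>
     (u < 3 * M + 18 \<and> v = cycle_next u) \<or> (v < 3 * M + 18 \<and> u = cycle_next v)"
  by (auto simp: hub_cycle_def edges_def doubleton_eq_iff)

lemma cycle_next_neq: "cycle_next w \<noteq> w"
proof (cases "w < 9")
  case True
  then show ?thesis by (auto simp: cycle_next_def mod_Suc)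
qed (auto simp: cycle_next_def cycle_hub_def)

lemma cycle_next_less: "w < 3 * M + 18 \<Longrightarrow> cycle_next w < 3 * M + 18"
  using mod_less_divisor[of 9 "w + 1"] unfolding cycle_next_def cycle_hub_def
  by (auto simp del: mod_less_divisor)

lemma is_graph_hub_cycle: "is_graph (hub_cycle M)"
  unfolding is_graph_def
proof (intro conjI ballI)
  fix e assume "e \<in> edges (hub_cycle M)"
  then obtain w where "w < 3 * M + 18" "e = {w, cycle_next w}"
    by (auto simp: hub_cycle_def edges_def)
  then show "\<exists>u v. e = {u, v} \<and> u \<noteq> v \<and> u \<in> verts (hub_cycle M) \<and> v \<in> verts (hub_cycle M)"
    using cycle_next_neq[of w] cycle_next_less[of w M]
    by (intro exI[of _ w] exI[of _ "cycle_next w"]) auto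
qed simp

text \<open>In these coordinates \<open>\<kappa>\<close> names the hub and \<open>v\<close> counts
  the vertices attached there. The arms are \<open>1 - 2\<close> and \<open>3 - 4\<close> at every
  hub, numbered as at hub \<open>0\<close> of \<open>hub_tree\<close>.\<close>

lemma cycle_next_pendant:
  assumes "1 \<le> v" "\<kappa> < 3"
  shows "cycle_next (3 * v + 6 + \<kappa>) =
    (if v = 2 \<or> v = 4 then 3 * (v - 1) + 6 + \<kappa> else cycle_hub \<kappa>)"
proof -
  have "(3 * v + 6 + \<kappa>) mod 3 = \<kappa>" using assms by presburger
  then show ?thesis using assms by (auto simp: cycle_next_def)
qed

lemma pendant_cases:
  assumes "9 \<le> (w::nat)"
  obtains v \<kappa> where "w = 3 * v + 6 + \<kappa>" "1 \<le> v" "\<kappa> < 3"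
  using assms by (intro that[of "(w - 6) div 3" "w mod 3"]) presburger+

text \<open>The retraction folds the long arc of the cycle onto the path between the two hubs and collapses
  everything pendant at the third hub.\<close>

lemma hub_tree_isometric_in_hub_cycle:
  assumes M: "9 \<le> M" and d: "d \<in> {2, 3, 4}"
  shows "\<exists>H. isometric_subgraph H (hub_cycle M) \<and> isomorphic (hub_tree M d) H"
proof -
  \<comment> \<open>The arc of length \<open>d\<close> starts at position \<open>s\<close> of the
    hub with index \<open>k\<close> and ends at the hub with index \<open>k'\<close>: from
    \<open>0\<close> to \<open>2\<close>, from \<open>2\<close> to \<open>5\<close>, or from
    \<open>5\<close> around to \<open>0\<close>.\<close>
  define k k' s where "k = d - 2" and "k' = (d - 1) mod 3" and "s = cycle_hub k"
  \<comment> \<open>The leaves of the second hub start at index \<open>5\<close>, past the two arms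
    that this hub carries in the cycle graph.\<close>
  define f where "f v = (if v = 0 then s else if v \<le> M then 3 * v + 6 + k
    else if v \<le> M + d then (s + (v - M)) mod 9 else 3 * (v - (M + d + 1) + 5) + 6 + k')" for v
  \<comment> \<open>\<open>min x (9 - x)\<close> is the distance from \<open>s\<close> on the cycle.
    It equals \<open>x\<close> on the arc because \<open>d \<le> 4\<close>, so the arc stays fixed;
    the start of the path is vertex \<open>0\<close> and not \<open>M\<close>, whence the case
    \<open>y = 0\<close>.\<close>
  define fold where "fold w = (let x = (w + 9 - s) mod 9; y = min d (min x (9 - x))
    in if y = 0 then 0 else M + y)" for w
  \<comment> \<open>Vertices attached to the two hubs of the arc go back to their preimages under
    \<open>f\<close>, and those without a preimage collapse to their hub.\<close>
  define r where "r w = (if w < 9 then fold w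
    else let v = (w - 6) div 3; \<kappa> = w mod 3 in
      if \<kappa> = k then (if v \<le> M then v else 0)
      else if \<kappa> = k' then (if 5 \<le> v \<and> v - 5 \<le> M - d then M + d + 1 + (v - 5) else M + d)
      else fold (cycle_hub \<kappa>))" for w
  have cs: "d = 2 \<and> k = 0 \<and> k' = 1 \<and> s = 0 \<or> d = 3 \<and> k = 1 \<and> k' = 2 \<and> s = 2 \<or>
      d = 4 \<and> k = 2 \<and> k' = 0 \<and> s = 5"
    using d by (auto simp: k_def k'_def s_def cycle_hub_def)
  have d4: "2 \<le> d" "d \<le> 4" using d by auto
  from cs have k: "k < 3" "k' < 3" "k \<noteq> k'" by auto
  have r_pendant: "r (3 * v + 6 + \<kappa>) = (if \<kappa> = k then (if v \<le> M then v else 0)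
      else if \<kappa> = k' then (if 5 \<le> v \<and> v - 5 \<le> M - d then M + d + 1 + (v - 5) else M + d)
      else fold (cycle_hub \<kappa>))" if "1 \<le> v" "\<kappa> < 3" for v \<kappa>
  proof -
    have "(3 * v + 6 + \<kappa>) mod 3 = \<kappa>" "(3 * v + 6 + \<kappa> - 6) div 3 = v" using that by presburger+
    then show ?thesis using that by (simp add: r_def)
  qed
  have hub: "cycle_hub \<kappa> < 9" for \<kappa> by (simp add: cycle_hub_def)
  have r_hub: "r (cycle_hub \<kappa>) = fold (cycle_hub \<kappa>)" for \<kappa> using hub by (simp add: r_def)
  have fold_k: "fold (cycle_hub k) = 0" "fold (cycle_hub k') = M + d"
    using cs by (elim disjE conjE; simp add: fold_def cycle_hub_def)+
  have s9: "s < 9" by (simp add: s_def hub)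
  have fold_less: "fold w < 2 * M + 2" for w
    using d4 M by (simp add: fold_def Let_def min_less_iff_disj)
  have r_less: "r w < 2 * M + 2" for w
  proof (cases "w < 9")
    case True
    then show ?thesis using fold_less by (simp add: r_def)
  next
    case False
    then obtain v \<kappa> where "w = 3 * v + 6 + \<kappa>" "1 \<le> v" "\<kappa> < 3"
      using pendant_cases[of w] by auto
    then show ?thesis using r_pendant[of v \<kappa>] fold_less[of "cycle_hub \<kappa>"] d4 M by auto
  qed
  have f_less: "f v < 3 * M + 18" if "v < 2 * M + 2" for v
    using that d4 M k s9 mod_less_divisor[of 9 "s + (v - M)"]
    by (auto simp: f_def simp del: mod_less_divisor)
  have fold_path: "fold ((s + x) mod 9) = M + x" if "0 < x" "x \<le> d" for x
  proof -
    have "x \<in> {1, 2, 3, 4}" using that d4 by auto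
    then show ?thesis using that cs
      unfolding insert_iff empty_iff by (elim disjE conjE; simp add: fold_def)
  qed
  have rf: "r (f v) = v" if "v < 2 * M + 2" for v
  proof -
    consider "v = 0" | "0 < v" "v \<le> M" | "M < v" "v \<le> M + d" | "M + d < v" by linarith
    then show ?thesis
    proof cases
      case 1
      then show ?thesis using fold_k r_hub by (simp add: f_def s_def)
    next
      case 2
      then show ?thesis using r_pendant[of v k] k by (simp add: f_def)
    next
      case 3
      then show ?thesis using fold_path[of "v - M"] by (simp add: f_def r_def)
    next
      case 4
      then obtain i where i: "v = M + d + 1 + i" using less_imp_Suc_add by fastforce
      then have "i \<le> M - d" using that by simp
      then show ?thesis using r_pendant[of "i + 5" k'] k i by (simp add: f_def)
    qed
  qed
  have next_path: "cycle_next ((s + x) mod 9) = (s + Suc x) mod 9" for x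
    by (simp add: cycle_next_def mod_Suc_eq)
  have next_hub: "(s + d) mod 9 = cycle_hub k'"
    using cs by (elim disjE conjE; simp add: cycle_hub_def)
  \<comment> \<open>Two cases are needed because \<open>cycle_next\<close> leads pendant vertices
    towards their hub, as \<open>hub_parent\<close> does, but runs along the arc away from the
    root.\<close>
  have f_parent: "f (hub_parent M d v) = cycle_next (f v) \<or> f v = cycle_next (f (hub_parent M d v))"
    if "0 < v" "v < 2 * M + 2" for v
  proof -
    consider "v \<le> M" | x where "v = M + Suc x" "Suc x \<le> d" | "M + d < v"
      using less_imp_Suc_add[of M v] by fastforce
    then show ?thesis
    proof cases
      case 1
      then show ?thesis using cycle_next_pendant[of v k] k that M
        by (auto simp: f_def hub_parent_def s_def)
    next
      case 2
      have "hub_parent M d v = (if x = 0 then 0 else M + x)" using 2 M by (simp add: hub_parent_def)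
      then have "f (hub_parent M d v) = (s + x) mod 9" using 2 s9 by (simp add: f_def)
      moreover have "f v = (s + Suc x) mod 9" using 2 by (simp add: f_def)
      ultimately show ?thesis using next_path by simp
    next
      case 3
      then have "hub_parent M d v = M + d" using M d4 by (simp add: hub_parent_def)
      moreover have "f (M + d) = cycle_hub k'" using next_hub d4 by (simp add: f_def)
      moreover have "f v = 3 * (v - (M + d + 1) + 5) + 6 + k'" using 3 by (simp add: f_def)
      ultimately show ?thesis using cycle_next_pendant[of "v - (M + d + 1) + 5" k'] k by simp
    qed
  qed
  have r_next: "r w = r (cycle_next w) \<or> {r w, r (cycle_next w)} \<in> edges (hub_tree M d)" for w
  proof (cases "w < 9")
    case True
    then have "w \<in> {0, 1, 2, 3, 4, 5, 6, 7, 8}" by simp presburger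
    then show ?thesis using cs M unfolding insert_iff empty_iff
      by (elim disjE conjE; simp add: cycle_next_def r_def fold_def edge_hub_tree_iff hub_parent_def)
  next
    case False
    then obtain v \<kappa> where w: "w = 3 * v + 6 + \<kappa>" "1 \<le> v" "\<kappa> < 3"
      using pendant_cases[of w] by auto
    show ?thesis
    proof (cases "v = 2 \<or> v = 4")
      case True
      \<comment> \<open>At the end of an arm: at hub \<open>k\<close> the arm is kept, at the other
        two hubs both of its vertices have the same image.\<close>
      then have "cycle_next w = 3 * (v - 1) + 6 + \<kappa>" using cycle_next_pendant w by simp
      moreover have "1 \<le> v - 1" "v \<le> M" "\<not> 5 \<le> v" "v - 1 \<le> M" "\<not> 5 \<le> v - 1"
        using True M by auto
      ultimately have eq: "r w = (if \<kappa> = k then v else if \<kappa> = k' then M + d else fold (cycle_hub \<kappa>))"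
        "r (cycle_next w) = (if \<kappa> = k then v - 1 else if \<kappa> = k' then M + d else fold (cycle_hub \<kappa>))"
        using r_pendant[of "v - 1" \<kappa>] r_pendant[of v \<kappa>] w by simp_all
      have "{v, v - 1} \<in> edges (hub_tree M d)"
        using True M by (auto simp: edge_hub_tree_iff hub_parent_def)
      then show ?thesis by (simp add: eq)
    next
      case False
      then have nxt: "cycle_next w = cycle_hub \<kappa>" using cycle_next_pendant w by simp
      consider "\<kappa> = k" | "\<kappa> = k'" | "\<kappa> \<noteq> k" "\<kappa> \<noteq> k'" by blast
      then show ?thesis
      proof cases
        case 1
        have "{v, 0} \<in> edges (hub_tree M d)" if "v \<le> M"
          using that False w M by (simp add: edge_hub_tree_iff hub_parent_def)
        then show ?thesis using 1 nxt r_pendant[of v \<kappa>] r_hub[of \<kappa>] fold_k w by simp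
      next
        case 2
        have leaf: "{M + d + 1 + i, M + d} \<in> edges (hub_tree M d)" if "i \<le> M - d" for i
          using that d4 M by (auto simp: edge_hub_tree_iff hub_parent_def)
        have "r (cycle_next w) = M + d" using 2 nxt r_hub[of \<kappa>] fold_k by simp
        moreover have "r w = M + d \<or> v - 5 \<le> M - d \<and> r w = M + d + 1 + (v - 5)"
          using 2 r_pendant[of v \<kappa>] w k by presburger
        ultimately show ?thesis using leaf by metis
      next
        case 3
        then show ?thesis using nxt r_pendant[of v \<kappa>] r_hub[of \<kappa>] w by simp
      qed
    qed
  qed
  show ?thesis
  proof (rule retract_isometric[OF is_graph_hub_tree])
    show "f ` verts (hub_tree M d) \<subseteq> verts (hub_cycle M)" using f_less by auto
    show "r ` verts (hub_cycle M) \<subseteq> verts (hub_tree M d)" using r_less by auto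
    show "r (f v) = v" if "v \<in> verts (hub_tree M d)" for v using rf that by simp
    show "{f u, f v} \<in> edges (hub_cycle M)" if e: "{u, v} \<in> edges (hub_tree M d)" for u v
    proof -
      have "f u = cycle_next (f v) \<or> f v = cycle_next (f u)"
        using e f_parent[of u] f_parent[of v] by (auto simp: edge_hub_tree_iff)
      moreover have "f u < 3 * M + 18" "f v < 3 * M + 18"
        using f_less edge_verts[OF is_graph_hub_tree e] by auto
      ultimately show ?thesis by (auto simp: edge_hub_cycle_iff)
    qed
    show "r u = r v \<or> {r u, r v} \<in> edges (hub_tree M d)" if "{u, v} \<in> edges (hub_cycle M)" for u v
      using that r_next[of u] r_next[of v] by (auto simp: edge_hub_cycle_iff insert_commute)
  qed
qed

section \<open>Lower bound for universal trees and conclusion\<close>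

text \<open>At most three vertices of large degree would be pairwise at distances \<open>2\<close>, \<open>3\<close>, \<open>4\<close>, giving a
  closed walk of length \<open>9\<close>; so a tree needs a fourth.\<close>

lemma universal_tree_card:
  assumes M: "5 \<le> M" and U: "is_tree U"
    and univ: "\<And>d. d \<in> {2, 3, 4} \<Longrightarrow> \<exists>H. isometric_subgraph H U \<and> isomorphic (hub_tree M d) H"
  shows "4 * (M - 2) \<le> card (verts U) + 6"
proof -
  have G: "is_graph U" and acyc: "\<nexists>cs. is_cycle U cs" and fin: "finite (verts U)"
    using U by (auto simp: is_tree_def is_graph_def)
  define S where "S = {v \<in> verts U. M - 2 \<le> card (nbrs U v)}"
  have finS: "finite S" using fin by (simp add: S_def)
  have pair: "\<exists>x\<in>S. \<exists>y\<in>S. dist U x y = enat d" if d: "d \<in> {2, 3, 4}" for d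
  proof -
    let ?T = "hub_tree M d"
    from univ[OF d] obtain H where H: "isometric_subgraph H U" "isomorphic ?T H" by blast
    from isometric_subgraph_embedding[OF is_graph_hub_tree H] obtain f where
      inj: "inj_on f (verts ?T)" and V: "f ` verts ?T \<subseteq> verts U"
      and E: "\<And>u v. {u, v} \<in> edges ?T \<Longrightarrow> {f u, f v} \<in> edges U"
      and D: "\<And>u v. u \<in> verts ?T \<Longrightarrow> v \<in> verts ?T \<Longrightarrow> dist U (f u) (f v) = dist ?T u v"
      by metis
    \<comment> \<open>An injective edge-preserving map cannot lower degrees, so both hubs of each
      tree land in \<open>S\<close>.\<close>
    have deg: "card (nbrs ?T v) \<le> card (nbrs U (f v))" for v
    proof (rule card_inj_on_le)
      show "inj_on f (nbrs ?T v)"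
        using inj nbrs_subset[OF is_graph_hub_tree] by (rule inj_on_subset)
      show "f ` nbrs ?T v \<subseteq> nbrs U (f v)" using E by (auto simp: nbrs_def)
    qed (rule finite_nbrs[OF G])
    have d4: "2 \<le> d" "d \<le> 4" "d \<le> M" using d M by auto
    have in_T: "0 \<in> verts ?T" "M + d \<in> verts ?T" using d4 by auto
    have "f 0 \<in> S" "f (M + d) \<in> S"
      using degree_hub_tree[OF M d4(1,2)] deg[of 0] deg[of "M + d"] V in_T
      by (auto simp: S_def simp del: verts_hub_tree)
    moreover have "dist U (f 0) (f (M + d)) = enat d"
      using D[OF in_T] dist_hub_tree[OF M d4(1,3)] by simp
    ultimately show ?thesis by blast
  qed
  have "4 \<le> card S"
  proof (rule ccontr)
    assume less: "\<not> 4 \<le> card S"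
    have no4: "\<not> distinct [a, b, c, e]" if "{a, b, c, e} \<subseteq> S" for a b c e
    proof
      assume "distinct [a, b, c, e]"
      then have "card {a, b, c, e} = 4" by simp
      then show False using card_mono[OF finS that] less by simp
    qed
    have dist_self: "dist U v v = enat 0" if "v \<in> S" for v
      using dist_le_walk[of U v v 0] that by (auto simp: S_def simp flip: zero_enat_def)
    obtain x2 y2 where 2: "x2 \<in> S" "y2 \<in> S" "dist U x2 y2 = enat 2" using pair[of 2] by auto
    obtain x3 y3 where 3: "x3 \<in> S" "y3 \<in> S" "dist U x3 y3 = enat 3" using pair[of 3] by auto
    obtain x4 y4 where 4: "x4 \<in> S" "y4 \<in> S" "dist U x4 y4 = enat 4" using pair[of 4] by auto
    have ne: "x2 \<noteq> y2" "x3 \<noteq> y3" "x4 \<noteq> y4" using 2 3 4 dist_self by auto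
    \<comment> \<open>Two pairs among at most three vertices overlap; the shared vertex is called
      \<open>q\<close>.\<close>
    have "x3 \<in> {x2, y2} \<or> y3 \<in> {x2, y2}"
      using no4[of x2 y2 x3 y3] 2 3 ne by auto
    then obtain p q r where pqr: "p \<in> S" "q \<in> S" "r \<in> S" "dist U p q = enat 2" "dist U q r = enat 3"
      using 2 3 dist_commute by (metis insertE singletonD)
    have dpqr: "p \<noteq> q" "q \<noteq> r" "p \<noteq> r" using pqr dist_self dist_commute[of U p q] by auto
    \<comment> \<open>\<open>p\<close>, \<open>q\<close>, \<open>r\<close> exhaust \<open>S\<close>,
      and the pairs at \<open>q\<close> have distances \<open>2\<close> and \<open>3\<close>, so
      distance \<open>4\<close> can only occur between \<open>r\<close> and
      \<open>p\<close>.\<close>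
    have "x4 \<in> {p, q, r}" "y4 \<in> {p, q, r}"
      using no4[of p q r x4] no4[of p q r y4] pqr 4 dpqr by auto
    then have "dist U r p = enat 4"
      using 4 ne pqr dist_commute[of U p q] dist_commute[of U q r] dist_commute[of U p r] by auto
    then have "walk U p p (2 + 3 + 4)"
      using pqr walk_append walk_of_dist by metis
    then show False using odd_closed_walk_imp_cycle[OF G, of "2 + 3 + 4" p] acyc by simp
  qed
  then obtain R where R: "R \<subseteq> S" "card R = 4" by (meson obtain_subset_with_card_n)
  then have "4 * (M - 2) \<le> card (\<Union>v\<in>R. nbrs U v) + (4 choose 2)"
    using acyclic_degree_bound[OF G acyc, of R "M - 2"] finite_subset[OF R(1) finS]
    by (auto simp: S_def)
  moreover have "card (\<Union>v\<in>R. nbrs U v) \<le> card (verts U)"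
    using nbrs_subset[OF G] by (intro card_mono fin) auto
  moreover have "(4 choose 2) = (6 :: nat)" by (simp add: numeral_eq_Suc)
  ultimately show ?thesis by linarith
qed

theorem theorem5:
  fixes t :: nat
  assumes "t \<ge> 9"
  shows "\<exists>T1 T2 T3.
           (\<forall>T\<in>{T1, T2, T3}. is_tree T \<and> card (verts T) = 2 * t ^ 3 + 2 \<and> pathwidth T = 2) \<and>
           (\<forall>U. is_tree U \<and> isometric_universal U {T1, T2, T3} \<longrightarrow>
                \<not> min_isometric_universal U {T1, T2, T3})"
proof -
  define M where "M = t ^ 3"
  have "9 ^ 3 \<le> M" unfolding M_def using assms by (intro power_mono) auto
  then have M: "729 \<le> M" by simp
  let ?F = "{hub_tree M 2, hub_tree M 3, hub_tree M 4}"
  have "isometric_universal (hub_cycle M) ?F"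
    using is_graph_hub_cycle hub_tree_isometric_in_hub_cycle[of M] M
    by (auto simp: isometric_universal_def)
  then have min: "min_universal_size ?F \<le> 3 * M + 18"
    unfolding min_universal_size_def by (intro Least_le exI[of _ "hub_cycle M"]) simp
  have "\<not> min_isometric_universal U ?F" if U: "is_tree U" "isometric_universal U ?F" for U
  proof -
    have "4 * (M - 2) \<le> card (verts U) + 6"
      using U(2) M by (intro universal_tree_card[OF _ U(1)]) (auto simp: isometric_universal_def)
    \<comment> \<open>The tree has at least \<open>4 * M - 14\<close> vertices, which exceeds
      \<open>3 * M + 18\<close> since \<open>M \<ge> 729\<close>.\<close>
    then show ?thesis using min M by (auto simp: min_isometric_universal_def)
  qed
  moreover have "\<forall>T\<in>?F. is_tree T \<and> card (verts T) = 2 * t ^ 3 + 2 \<and> pathwidth T = 2"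
    using is_tree_hub_tree pathwidth_hub_tree M by (auto simp: M_def)
  ultimately show ?thesis by blast
qed

end
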